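(* Let $(c_j)_{j\ge1}$ be any sequence of non-negative real numbers, and for $j\ge1$ let $$I_j(c_j):=\int_{[0,1]^j}\frac{{\rm d}x_1\,{\rm d}x_2\cdots{\rm d}x_j}{1+x_1(1+x_2(\cdots(1+x_{j-1}(1+c_jx_j))\cdots))}.$$ Then $I_j(c_j)=e^{-\gamma}+O\big(2^{-j}(1+c_j)\big)$, where $\gamma$ is the Euler--Mascheroni constant and the implied constant is absolute.
   Context: For $j=1$ the integrand is $1/(1+c_1x_1)$. *)

theory Defs
  imports "HOL-Analysis.Analysis"
begin

text \<open>
  Folding from the right over the indices \<open>1, \<dots>, j\<close> gives
  \<open>1 + x\<^sub>1 (1 + x\<^sub>2 (\<cdots> (1 + x\<^sub>j\<^sub>-\<^sub>1 (1 + x\<^sub>j c)) \<cdots>))\<close> for \<open>j \<ge> 1\<close>.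
\<close>

definition nested_denom :: "nat \<Rightarrow> real \<Rightarrow> (nat \<Rightarrow> real) \<Rightarrow> real" where
  "nested_denom j c x = foldr (\<lambda>i t. 1 + x i * t) [1..<Suc j] c"

lemma nested_denom_1: "nested_denom 1 c x = 1 + c * x 1"
  by (simp add: nested_denom_def)

lemma nested_denom_3: "nested_denom 3 c x = 1 + x 1 * (1 + x 2 * (1 + c * x 3))"
  by (simp add: nested_denom_def upt_rec numeral_eq_Suc mult.commute)

text \<open>
  Points of \<open>[0,1]\<^sup>j\<close> are functions on the index set \<open>{1..j}\<close>, and the measure is the product of
  \<open>j\<close> copies of one-dimensional Lebesgue measure.  For \<open>c \<ge> 0\<close> the integrand is measurable with
  values in \<open>(0, 1]\<close> on the cube, so the Bochner integral is a genuine one.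
\<close>

definition nested_integral :: "nat \<Rightarrow> real \<Rightarrow> real" where
  "nested_integral j c =
     (LINT x : (\<Pi>\<^sub>E i\<in>{1..j}. {0..1}) | (\<Pi>\<^sub>M i\<in>{1..j}. lborel). 1 / nested_denom j c x)"

end

theory Submission
  imports Defs "HOL-Real_Asymp.Real_Asymp"
begin

text \<open>
  For uniform random \<open>x\<^sub>i\<close> the denominator \<open>D\<^sub>j\<close> is a Markov chain \<open>t \<mapsto> 1 + x t\<close> started at \<open>c\<close>.  Its
  Laplace transform \<open>\<psi>\<^sub>j(s) = E exp(-s D\<^sub>j)\<close> satisfies \<open>\<psi>\<^sub>j\<^sub>+\<^sub>1(s) = exp(-s) \<integral>\<^sub>0\<^sup>1 \<psi>\<^sub>j(s x) dx\<close>, and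
  \<open>I\<^sub>j(c) = \<integral>\<^sub>0\<^sup>\<infinity> \<psi>\<^sub>j(s) ds\<close>.  This recursion fixes \<open>\<phi>(s) = exp(-s - Ein s)\<close> and halves a bound of the
  form \<open>\<bar>\<psi>\<^sub>j(s) - \<phi>(s)\<bar> \<le> K s\<close>, which holds for \<open>j = 0\<close> with \<open>K = 2 + c\<close>; the last step contributes the
  factor \<open>exp(-s)\<close> that makes the error integrable.  Finally \<open>\<phi>\<close> is the derivative of \<open>s exp(-Ein s)\<close>,
  and \<open>Ein s - ln s\<close> tends to \<open>\<gamma>\<close>, so \<open>\<phi>\<close> has integral \<open>exp(-\<gamma>)\<close>.
\<close>


section \<open>The entire exponential integral\<close>

text \<open>The value at \<open>0\<close> removes the singularity, so the function is continuous and
  has an antiderivative on the whole line.\<close>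

definition ein_deriv :: "real \<Rightarrow> real" where
  "ein_deriv u = (if u = 0 then 1 else (1 - exp (- u)) / u)"

lemma ein_deriv_mult: "u * ein_deriv u = 1 - exp (- u)"
  by (simp add: ein_deriv_def)

lemma ein_deriv_nonneg: "0 \<le> u \<Longrightarrow> 0 \<le> ein_deriv u"
  by (simp add: ein_deriv_def)

lemma ein_deriv_le_1: "0 \<le> u \<Longrightarrow> ein_deriv u \<le> 1"
  using exp_ge_add_one_self[of "- u"] by (simp add: ein_deriv_def field_simps)

lemma isCont_ein_deriv: "isCont ein_deriv u"
proof (cases "u = 0")
  case True
  have "((\<lambda>x::real. (1 - exp (- x)) / x) \<longlongrightarrow> 1) (at 0)"
    by real_asymp
  then have "(ein_deriv \<longlongrightarrow> 1) (at 0)"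
    by (rule Lim_transform_eventually) (auto simp: ein_deriv_def eventually_at_filter)
  then show ?thesis
    using True by (simp add: isCont_def ein_deriv_def)
next
  case False
  have "isCont (\<lambda>x. (1 - exp (- x)) / x) u"
    using False by (intro continuous_intros) auto
  moreover have "\<forall>\<^sub>F x in nhds u. (1 - exp (- x)) / x = ein_deriv x"
    using t1_space_nhds[OF False] by eventually_elim (simp add: ein_deriv_def)
  ultimately show ?thesis
    by (simp add: isCont_cong)
qed

text \<open>The entire exponential integral, the antiderivative of \<open>(1 - exp (-u)) / u\<close> that vanishes at \<open>0\<close>.\<close>

definition ein :: "real \<Rightarrow> real" where
  "ein = (SOME F. F 0 = 0 \<and> (\<forall>s. (F has_real_derivative ein_deriv s) (at s)))"

lemma ein_0 [simp]: "ein 0 = 0"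
  and ein_has_derivative: "(ein has_real_derivative ein_deriv s) (at s)"
proof -
  obtain F where F: "\<And>s. (F has_real_derivative ein_deriv s) (at s)"
    using einterval_antiderivative[of "-\<infinity>" "\<infinity>" ein_deriv] isCont_ein_deriv
    by (auto simp: has_real_derivative_iff_has_vector_derivative)
  have "\<exists>F. F 0 = 0 \<and> (\<forall>s. (F has_real_derivative ein_deriv s) (at s))"
    by (rule exI[of _ "\<lambda>s. F s - F 0"]) (auto intro!: derivative_eq_intros F)
  then have "ein 0 = 0 \<and> (\<forall>s. (ein has_real_derivative ein_deriv s) (at s))"
    unfolding ein_def by (rule someI_ex)
  then show "ein 0 = 0" "(ein has_real_derivative ein_deriv s) (at s)"
    by auto
qed

lemmas ein_has_derivative' [derivative_intros] = DERIV_chain2[OF ein_has_derivative]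

lemma continuous_on_ein: "continuous_on A ein"
  by (meson DERIV_isCont continuous_at_imp_continuous_on ein_has_derivative)

lemma ein_measurable [measurable]: "ein \<in> borel_measurable borel"
  by (intro borel_measurable_continuous_onI continuous_on_ein)

lemma ein_nonneg: "0 \<le> s \<Longrightarrow> 0 \<le> ein s"
  using DERIV_nonneg_imp_nondecreasing[of 0 s ein] ein_has_derivative ein_deriv_nonneg by fastforce

lemma ein_le: assumes "0 \<le> s" shows "ein s \<le> s"
proof -
  have "ein 0 - 0 \<ge> ein s - s"
  proof (rule DERIV_nonpos_imp_nonincreasing[OF assms])
    fix x :: real assume "0 \<le> x"
    then show "\<exists>y. ((\<lambda>s. ein s - s) has_real_derivative y) (at x) \<and> y \<le> 0"
      by (intro exI[of _ "ein_deriv x - 1"])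
        (auto intro!: derivative_eq_intros simp: ein_deriv_le_1)
  qed
  then show ?thesis by simp
qed

section \<open>Comparison of \<open>ein\<close> with harmonic numbers\<close>

lemma power_one_minus_le_exp:
  assumes "0 \<le> s" "s \<le> real n" "0 < n"
  shows "(1 - s / n) ^ n \<le> exp (- s)"
proof -
  have "(1 - s / n) ^ n \<le> exp (- s / n) ^ n"
    using assms exp_ge_add_one_self[of "- s / n"] by (intro power_mono) auto
  also have "\<dots> = exp (- s)"
    using assms by (simp flip: exp_of_nat_mult)
  finally show ?thesis .
qed

text \<open>Bernoulli bounds \<open>1 - s^2 / n\<close> by \<open>(1 - s^2 / n^2) ^ n\<close>, which
  factors as \<open>(1 + s / n) ^ n * (1 - s / n) ^ n\<close>; the first factor is at most
  \<open>exp s\<close>.\<close>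

lemma exp_minus_power_le:
  assumes "0 \<le> s" "s \<le> real n" "0 < n"
  shows "exp (- s) - (1 - s / n) ^ n \<le> s\<^sup>2 * exp (- s) / n"
proof -
  have sn: "0 \<le> s / n" "s / n \<le> 1"
    using assms by auto
  have "1 - s\<^sup>2 / n = 1 + real n * (- (s / n)\<^sup>2)"
    using assms by (simp add: power2_eq_square)
  also have "\<dots> \<le> (1 + (- (s / n)\<^sup>2)) ^ n"
    using sn by (intro Bernoulli_inequality) (simp add: power_le_one)
  also have "\<dots> = (1 + s / n) ^ n * (1 - s / n) ^ n"
    by (simp add: power2_eq_square algebra_simps flip: power_mult_distrib)
  also have "\<dots> \<le> exp (s / n) ^ n * (1 - s / n) ^ n"
    using sn exp_ge_add_one_self[of "s / n"] by (intro mult_right_mono power_mono) auto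
  also have "\<dots> = exp s * (1 - s / n) ^ n"
    using assms by (simp flip: exp_of_nat_mult)
  finally have "exp (- s) * (1 - s\<^sup>2 / n) \<le> exp (- s) * (exp s * (1 - s / n) ^ n)"
    by (intro mult_left_mono) auto
  also have "\<dots> = (1 - s / n) ^ n"
    by (simp add: exp_minus)
  finally show ?thesis
    by (simp add: algebra_simps)
qed

text \<open>
  The polynomial \<open>\<Sum>k=1..n. (1 - (1 - s/n)\<^sup>k) / k\<close> equals \<open>H\<^sub>n\<close> at \<open>s = n\<close>, and its derivative
  \<open>(1 - (1 - s/n)\<^sup>n) / s\<close> approximates that of \<open>ein\<close> with an error of at most \<open>s exp (-s) / n\<close>.
\<close>

lemma ein_harm_bounds:
  assumes n: "0 < n"
  shows "harm n - 1 / n \<le> ein (real n)" "ein (real n) \<le> harm n"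
proof -
  define A where "A = (\<lambda>s. \<Sum>k=1..n. (1 - (1 - s / n) ^ k) / real k)"
  define a where "a = (\<lambda>s. \<Sum>k<n. (1 - s / n) ^ k / real n)"
  have A_deriv: "(A has_real_derivative a s) (at s)" for s
  proof -
    have "(A has_real_derivative (\<Sum>k=1..n. (1 - s / n) ^ (k - 1) / real n)) (at s)"
      unfolding A_def
    proof (rule DERIV_sum)
      fix k assume "k \<in> {1..n}"
      then show "((\<lambda>s. (1 - (1 - s / n) ^ k) / real k) has_real_derivative
          (1 - s / n) ^ (k - 1) / real n) (at s)"
        using n by (auto intro!: derivative_eq_intros)
    qed
    also have "(\<Sum>k=1..n. (1 - s / n) ^ (k - 1) / real n) = a s"
      unfolding a_def by (rule sum.reindex_bij_witness[of _ Suc "\<lambda>k. k - 1"]) auto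
    finally show ?thesis .
  qed
  have a_mult: "s * a s = 1 - (1 - s / n) ^ n" for s
    using one_diff_power_eq[of "1 - s / n" n] n
    by (simp add: a_def sum_distrib_left sum_distrib_right field_simps)
  have a_0: "a 0 = 1"
    using n by (simp add: a_def)
  have bounds: "ein_deriv s \<le> a s" "a s \<le> ein_deriv s + s * exp (- s) / n"
    if "0 \<le> s" "s \<le> real n" for s
  proof -
    have "ein_deriv s \<le> a s \<and> a s \<le> ein_deriv s + s * exp (- s) / n"
    proof (cases "s = 0")
      case False
      have "s * ein_deriv s \<le> s * a s"
        using power_one_minus_le_exp[OF that n] by (simp add: a_mult ein_deriv_mult)
      moreover have "s * a s \<le> s * (ein_deriv s + s * exp (- s) / n)"
        using exp_minus_power_le[OF that n]
        by (simp add: a_mult ein_deriv_mult distrib_left power2_eq_square mult.assoc)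
      ultimately show ?thesis
        using False that by simp
    qed (simp add: a_0 ein_deriv_def)
    then show "ein_deriv s \<le> a s" "a s \<le> ein_deriv s + s * exp (- s) / n"
      by auto
  qed
  have A_0: "A 0 = 0"
    by (simp add: A_def)
  have A_n: "A n = harm n"
    using n by (auto simp: A_def harm_def inverse_eq_divide intro!: sum.cong)
  have "ein 0 - A 0 \<ge> ein n - A n"
  proof (rule DERIV_nonpos_imp_nonincreasing[of 0 "real n" "\<lambda>s. ein s - A s"])
    fix s assume "0 \<le> s" "s \<le> real n"
    then show "\<exists>y. ((\<lambda>s. ein s - A s) has_real_derivative y) (at s) \<and> y \<le> 0"
      using bounds
      by (intro exI[of _ "ein_deriv s - a s"])
        (auto intro!: derivative_eq_intros A_deriv)
  qed simp
  then show "ein n \<le> harm n"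
    by (simp add: A_0 A_n)
  \<comment> \<open>The last term has derivative \<open>s * exp (- s) / n\<close>, the allowed error
    of \<open>a\<close>, so \<open>D\<close> increases. It starts at \<open>- 1 / n\<close>, which
    becomes the loss in the lower bound.\<close>
  define D where "D = (\<lambda>s. ein s - A s - (s + 1) * exp (- s) / n)"
  have "D 0 \<le> D n"
  proof (rule DERIV_nonneg_imp_nondecreasing[of 0 "real n" D])
    fix s assume "0 \<le> s" "s \<le> real n"
    then show "\<exists>y. (D has_real_derivative y) (at s) \<and> 0 \<le> y"
      unfolding D_def using bounds[of s] n
      by (intro exI[of _ "ein_deriv s - a s + s * exp (- s) / n"])
        (auto intro!: derivative_eq_intros A_deriv simp: field_simps)
  qed simp
  moreover have "(real n + 1) * exp (- real n) / n \<ge> 0"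
    by simp
  ultimately show "harm n - 1 / n \<le> ein (real n)"
    unfolding D_def A_0 A_n ein_0 by (simp only: exp_zero minus_zero add_0 mult_1)
qed

section \<open>The limiting Laplace transform and its integral\<close>

text \<open>Antiderivative of \<open>stat_laplace\<close> that vanishes at \<open>0\<close>.\<close>

definition mult_exp_ein :: "real \<Rightarrow> real" where
  "mult_exp_ein s = s * exp (- ein s)"

definition stat_laplace :: "real \<Rightarrow> real" where
  "stat_laplace s = exp (- s - ein s)"

lemma stat_laplace_nonneg [simp]: "0 \<le> stat_laplace s"
  and stat_laplace_measurable [measurable]: "stat_laplace \<in> borel_measurable borel"
  and stat_laplace_0 [simp]: "stat_laplace 0 = 1"
  by (simp_all add: stat_laplace_def[abs_def])

lemma mult_exp_ein_has_derivative: "(mult_exp_ein has_real_derivative stat_laplace s) (at s)"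
proof -
  have "exp (- ein s) - s * ein_deriv s * exp (- ein s) = stat_laplace s"
    by (simp add: ein_deriv_mult stat_laplace_def algebra_simps flip: exp_add)
  then show ?thesis
    unfolding mult_exp_ein_def[abs_def] by (auto intro!: derivative_eq_intros simp: algebra_simps)
qed

lemma mult_exp_ein_mono: "s \<le> t \<Longrightarrow> mult_exp_ein s \<le> mult_exp_ein t"
  by (rule DERIV_nonneg_imp_nondecreasing)
    (auto intro!: exI[of _ "stat_laplace _"] mult_exp_ein_has_derivative)

text \<open>For \<open>n > 0\<close> the term is \<open>exp (ln n - ein n)\<close>, and
  \<open>ein n\<close> may be replaced by \<open>harm n\<close> in the limit.\<close>

lemma mult_exp_ein_LIMSEQ:
  "(\<lambda>n. mult_exp_ein (real n)) \<longlonglongrightarrow> exp (- euler_mascheroni)"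
proof (rule Lim_transform_eventually)
  have "(\<lambda>n. ein (real n) - harm n) \<longlonglongrightarrow> 0"
  proof (rule tendsto_sandwich)
    show "\<forall>\<^sub>F n in sequentially. - 1 / real n \<le> ein (real n) - harm n"
      using eventually_gt_at_top[of 0] by eventually_elim (use ein_harm_bounds(1) in \<open>simp add: algebra_simps\<close>)
    show "\<forall>\<^sub>F n in sequentially. ein (real n) - harm n \<le> 0"
      using eventually_gt_at_top[of 0] by eventually_elim (use ein_harm_bounds(2) in \<open>simp add: algebra_simps\<close>)
    show "(\<lambda>n. - 1 / real n) \<longlonglongrightarrow> 0"
      by real_asymp
  qed simp
  then have "(\<lambda>n. exp (- ((ein (real n) - harm n) + (harm n - ln (real n))))) \<longlonglongrightarrow>
      exp (- (0 + euler_mascheroni))"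
    by (intro tendsto_intros euler_mascheroni_LIMSEQ)
  then show "(\<lambda>n. exp (ln (real n) - ein (real n))) \<longlonglongrightarrow> exp (- euler_mascheroni)"
    by (simp add: algebra_simps)
  show "\<forall>\<^sub>F n in sequentially. exp (ln (real n) - ein (real n)) = mult_exp_ein (real n)"
    using eventually_gt_at_top[of 0]
    by eventually_elim (simp add: mult_exp_ein_def exp_diff exp_minus field_simps)
qed

text \<open>Monotonicity carries the limit from integers to reals, by squeezing between floor and
  ceiling.\<close>

lemma mult_exp_ein_tendsto: "(mult_exp_ein \<longlongrightarrow> exp (- euler_mascheroni)) at_top"
proof (rule tendsto_sandwich)
  have floor: "filterlim (\<lambda>x::real. nat \<lfloor>x\<rfloor>) sequentially at_top"
    by real_asymp
  show "((\<lambda>x::real. mult_exp_ein (real (nat \<lfloor>x\<rfloor>))) \<longlongrightarrow> exp (- euler_mascheroni)) at_top"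
    using filterlim_compose[OF mult_exp_ein_LIMSEQ floor] .
  have ceiling: "filterlim (\<lambda>x::real. nat \<lceil>x\<rceil>) sequentially at_top"
    by real_asymp
  show "((\<lambda>x::real. mult_exp_ein (real (nat \<lceil>x\<rceil>))) \<longlongrightarrow> exp (- euler_mascheroni)) at_top"
    using filterlim_compose[OF mult_exp_ein_LIMSEQ ceiling] .
  show "\<forall>\<^sub>F x::real in at_top. mult_exp_ein (real (nat \<lfloor>x\<rfloor>)) \<le> mult_exp_ein x"
    using eventually_ge_at_top[of 0] by eventually_elim (intro mult_exp_ein_mono, linarith)
  show "\<forall>\<^sub>F x::real in at_top. mult_exp_ein x \<le> mult_exp_ein (real (nat \<lceil>x\<rceil>))"
    by (intro always_eventually allI mult_exp_ein_mono) linarith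
qed

lemma nn_integral_stat_laplace:
  "(\<integral>\<^sup>+s\<in>{0..}. ennreal (stat_laplace s) \<partial>lborel) = ennreal (exp (- euler_mascheroni))"
  by (subst nn_integral_FTC_atLeast[where F = mult_exp_ein and T = "exp (- euler_mascheroni)"])
    (auto intro: mult_exp_ein_has_derivative mult_exp_ein_tendsto simp: mult_exp_ein_def)

text \<open>For \<open>s > 0\<close> the mean of \<open>stat_laplace\<close> over
  \<open>[0, s]\<close> is \<open>mult_exp_ein s / s = exp (- ein s)\<close>.\<close>

lemma stat_laplace_fixed_point:
  assumes "0 \<le> s"
  shows "ennreal (stat_laplace s) =
    ennreal (exp (- s)) * (\<integral>\<^sup>+x\<in>{0..1}. ennreal (stat_laplace (s * x)) \<partial>lborel)"
proof (cases "s = 0")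
  case False
  have "(\<integral>\<^sup>+x\<in>{0..1}. ennreal (stat_laplace (s * x)) \<partial>lborel) =
      ennreal (mult_exp_ein (s * 1) / s - mult_exp_ein (s * 0) / s)"
  proof (rule nn_integral_FTC_Icc)
    fix x :: real
    show "((\<lambda>x. mult_exp_ein (s * x) / s) has_real_derivative stat_laplace (s * x)) (at x)"
      using False
      by (auto intro!: derivative_eq_intros DERIV_chain2[OF mult_exp_ein_has_derivative])
  qed auto
  also have "\<dots> = ennreal (exp (- ein s))"
    using False by (simp add: mult_exp_ein_def)
  finally show ?thesis
    by (simp add: stat_laplace_def exp_diff exp_minus ennreal_mult' flip: divide_inverse)
      (simp add: divide_inverse ennreal_mult')
qed simp


section \<open>Laplace transforms of the nested denominators\<close>

text \<open>
  The Laplace transform of \<open>nested_denom j c\<close> at \<open>s\<close>, conditioned on the outermost variable.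
  Conditioning on the innermost one instead gives \<open>nested_laplace_Suc_right\<close>.
\<close>

primrec nested_laplace :: "nat \<Rightarrow> real \<Rightarrow> real \<Rightarrow> ennreal" where
  "nested_laplace 0 s c = ennreal (exp (- (s * c)))"
| "nested_laplace (Suc j) s c =
    ennreal (exp (- s)) * (\<integral>\<^sup>+x\<in>{0..1}. nested_laplace j (s * x) c \<partial>lborel)"

text \<open>Joint measurability is needed because the later Fubini swaps vary both arguments at
  once.\<close>

lemma nested_laplace_measurable_pair:
  "(\<lambda>p. nested_laplace j (fst p) (snd p)) \<in> borel_measurable (borel \<Otimes>\<^sub>M borel)"
proof (induction j)
  case (Suc j)
  note [measurable] = Suc.IH
  have [measurable]: "(\<lambda>q. nested_laplace j (fst (fst q) * snd q) (snd (fst q)))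
      \<in> borel_measurable ((borel \<Otimes>\<^sub>M borel) \<Otimes>\<^sub>M lborel)"
  proof -
    have "(\<lambda>q :: (real \<times> real) \<times> real. (fst (fst q) * snd q, snd (fst q)))
        \<in> (borel \<Otimes>\<^sub>M borel) \<Otimes>\<^sub>M lborel \<rightarrow>\<^sub>M borel \<Otimes>\<^sub>M (borel :: real measure)"
      by measurable
    from measurable_compose[OF this Suc.IH] show ?thesis
      by simp
  qed
  show ?case
    by simp
qed simp

lemma nested_laplace_measurable [measurable (raw)]:
  assumes [measurable]: "f \<in> borel_measurable M" "g \<in> borel_measurable M"
  shows "(\<lambda>x. nested_laplace j (f x) (g x)) \<in> borel_measurable M"
  using measurable_compose[OF _ nested_laplace_measurable_pair, of "\<lambda>x. (f x, g x)"] by simp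

lemma set_nn_integral_swap:
  fixes F :: "real \<Rightarrow> real \<Rightarrow> ennreal"
  assumes [measurable]: "case_prod F \<in> borel_measurable (lborel \<Otimes>\<^sub>M lborel)"
    "A \<in> sets borel" "B \<in> sets borel"
  shows "(\<integral>\<^sup>+x\<in>A. (\<integral>\<^sup>+y\<in>B. F x y \<partial>lborel) \<partial>lborel) = (\<integral>\<^sup>+y\<in>B. (\<integral>\<^sup>+x\<in>A. F x y \<partial>lborel) \<partial>lborel)"
proof -
  have "(\<integral>\<^sup>+x\<in>A. (\<integral>\<^sup>+y\<in>B. F x y \<partial>lborel) \<partial>lborel) =
      (\<integral>\<^sup>+x. (\<integral>\<^sup>+y. F x y * indicator B y * indicator A x \<partial>lborel) \<partial>lborel)"
    by (simp add: nn_integral_multc)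
  also have "\<dots> = (\<integral>\<^sup>+y. (\<integral>\<^sup>+x. F x y * indicator B y * indicator A x \<partial>lborel) \<partial>lborel)"
    by (rule lborel_pair.Fubini') measurable
  also have "\<dots> = (\<integral>\<^sup>+y. (\<integral>\<^sup>+x. F x y * indicator A x * indicator B y \<partial>lborel) \<partial>lborel)"
    by (simp only: mult_ac)
  also have "\<dots> = (\<integral>\<^sup>+y\<in>B. (\<integral>\<^sup>+x\<in>A. F x y \<partial>lborel) \<partial>lborel)"
    by (simp add: nn_integral_multc)
  finally show ?thesis .
qed

text \<open>By Fubini the outermost and innermost averages commute. This form matches the cube
  integral, where the last coordinate is split off.\<close>

lemma nested_laplace_Suc_right:
  "nested_laplace (Suc j) s c = (\<integral>\<^sup>+y\<in>{0..1}. nested_laplace j s (1 + y * c) \<partial>lborel)"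
proof (induction j arbitrary: s)
  case 0
  have "ennreal (exp (- s)) * ennreal (exp (- (s * x * c))) = ennreal (exp (- (s * (1 + x * c))))"
    for x
    by (simp add: algebra_simps flip: ennreal_mult' exp_add)
  then show ?case
    by (simp add: mult.assoc[symmetric] flip: nn_integral_cmult)
next
  case (Suc j)
  have "nested_laplace (Suc (Suc j)) s c = ennreal (exp (- s)) *
      (\<integral>\<^sup>+x\<in>{0..1}. (\<integral>\<^sup>+y\<in>{0..1}. nested_laplace j (s * x) (1 + y * c) \<partial>lborel) \<partial>lborel)"
    by (simp only: nested_laplace.simps(2)[of "Suc j"] Suc.IH)
  also have "\<dots> = ennreal (exp (- s)) *
      (\<integral>\<^sup>+y\<in>{0..1}. (\<integral>\<^sup>+x\<in>{0..1}. nested_laplace j (s * x) (1 + y * c) \<partial>lborel) \<partial>lborel)"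
    by (subst set_nn_integral_swap) auto
  also have "\<dots> = (\<integral>\<^sup>+y\<in>{0..1}. nested_laplace (Suc j) s (1 + y * c) \<partial>lborel)"
    by (subst nn_integral_cmult[symmetric]) (simp_all add: mult.assoc)
  finally show ?case .
qed

section \<open>The cube integral as an integral of Laplace transforms\<close>

lemma measurable_foldr_denom:
  "set is \<subseteq> I \<Longrightarrow>
    (\<lambda>x. foldr (\<lambda>i t. 1 + x i * t) is c) \<in> borel_measurable (\<Pi>\<^sub>M i\<in>I. (lborel :: real measure))"
proof (induction "is")
  case (Cons i "is")
  then have [measurable]: "i \<in> I"
    "(\<lambda>x. foldr (\<lambda>i t. 1 + x i * t) is c) \<in> borel_measurable (\<Pi>\<^sub>M i\<in>I. (lborel :: real measure))"
    by auto
  show ?case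
    by simp
qed simp

lemma nested_denom_measurable [measurable]:
  "nested_denom j c \<in> borel_measurable (\<Pi>\<^sub>M i\<in>{1..j}. lborel)"
  unfolding nested_denom_def[abs_def] by (rule measurable_foldr_denom) auto

lemma nested_denom_0 [simp]: "nested_denom 0 c x = c"
  by (simp add: nested_denom_def)

text \<open>The last variable is innermost, so fixing it only changes the starting value of the
  fold.\<close>

lemma nested_denom_Suc: "nested_denom (Suc j) c (x(Suc j := y)) = nested_denom j (1 + y * c) x"
  unfolding nested_denom_def by (auto intro!: foldr_cong)

lemma foldr_denom_nonneg:
  "(\<And>i. i \<in> set is \<Longrightarrow> 0 \<le> x i) \<Longrightarrow> 0 \<le> c \<Longrightarrow> 0 \<le> foldr (\<lambda>i t. 1 + x i * t :: real) is c"
  by (induction "is") auto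

lemma nested_denom_nonneg:
  "0 \<le> c \<Longrightarrow> x \<in> (\<Pi>\<^sub>E i\<in>{1..j}. {0..1}) \<Longrightarrow> 0 \<le> nested_denom j c x"
  unfolding nested_denom_def by (rule foldr_denom_nonneg) (auto simp: PiE_iff)

lemma nn_integral_exp_Ici:
  assumes "0 < (c :: real)"
  shows "(\<integral>\<^sup>+s\<in>{0..}. ennreal (exp (- (s * c))) \<partial>lborel) = ennreal (1 / c)"
proof -
  have "(\<integral>\<^sup>+s\<in>{0..}. ennreal (exp (- (s * c))) \<partial>lborel) = ennreal (0 - (- exp (- (0 * c)) / c))"
  proof (rule nn_integral_FTC_atLeast)
    show "((\<lambda>s. - exp (- (s * c)) / c) \<longlongrightarrow> 0) at_top"
      using assms by real_asymp
  qed (use assms in \<open>auto intro!: derivative_eq_intros\<close>)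
  then show ?thesis
    by simp
qed

lemma nn_integral_id_exp_Ici:
  "(\<integral>\<^sup>+s\<in>{0..}. ennreal (s * exp (- s)) \<partial>lborel) = 1"
proof -
  have "(\<integral>\<^sup>+s\<in>{0..}. ennreal (s * exp (- s)) \<partial>lborel) = ennreal (0 - (- (0 + 1) * exp (- 0)))"
  proof (rule nn_integral_FTC_atLeast)
    show "((\<lambda>s::real. - (s + 1) * exp (- s)) \<longlongrightarrow> 0) at_top"
      by real_asymp
  qed (auto intro!: derivative_eq_intros simp: algebra_simps)
  then show ?thesis
    by simp
qed

text \<open>Values in \<open>ennreal\<close> allow Fubini without integrability proofs; finiteness
  follows later from the upper bound.\<close>

definition cube_nn_integral :: "nat \<Rightarrow> real \<Rightarrow> ennreal" where
  "cube_nn_integral j c =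
    (\<integral>\<^sup>+x\<in>(\<Pi>\<^sub>E i\<in>{1..j}. {0..1}). ennreal (1 / nested_denom j c x) \<partial>(\<Pi>\<^sub>M i\<in>{1..j}. lborel))"

lemma cube_in_sets [measurable]: "(\<Pi>\<^sub>E i\<in>{1..j::nat}. {0..1::real}) \<in> sets (\<Pi>\<^sub>M i\<in>{1..j}. lborel)"
  by (intro sets_PiM_I_finite) auto

lemma nested_integral_eq_cube_nn_integral:
  assumes "0 \<le> c"
  shows "nested_integral j c = enn2real (cube_nn_integral j c)"
proof -
  have "nested_integral j c = enn2real (\<integral>\<^sup>+x. ennreal
      (indicat_real (\<Pi>\<^sub>E i\<in>{1..j}. {0..1}) x *\<^sub>R (1 / nested_denom j c x)) \<partial>(\<Pi>\<^sub>M i\<in>{1..j}. lborel))"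
    unfolding nested_integral_def set_lebesgue_integral_def
  proof (rule integral_eq_nn_integral)
    show "(\<lambda>x. indicat_real (\<Pi>\<^sub>E i\<in>{1..j}. {0..1}) x *\<^sub>R (1 / nested_denom j c x))
        \<in> borel_measurable (\<Pi>\<^sub>M i\<in>{1..j}. lborel)"
      by measurable
  qed (use nested_denom_nonneg[OF assms] in \<open>auto simp: indicator_def\<close>)
  also have "\<dots> = enn2real (cube_nn_integral j c)"
    unfolding cube_nn_integral_def
    by (intro arg_cong[of _ _ enn2real] nn_integral_cong) (auto simp: indicator_def)
  finally show ?thesis .
qed

lemma cube_nn_integral_Suc:
  "cube_nn_integral (Suc j) c = (\<integral>\<^sup>+y\<in>{0..1}. cube_nn_integral j (1 + y * c) \<partial>lborel)"
proof -
  interpret product_sigma_finite "\<lambda>_::nat. lborel :: real measure" ..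
  define F where "F = (\<lambda>x. ennreal (1 / nested_denom (Suc j) c x) *
    indicator (\<Pi>\<^sub>E i\<in>{1..Suc j}. {0..1}) x)"
  have [measurable]: "F \<in> borel_measurable (\<Pi>\<^sub>M i\<in>{1..Suc j}. lborel)"
    unfolding F_def by measurable
  have ins: "{1..Suc j} = insert (Suc j) {1..j}"
    by auto
  have "cube_nn_integral (Suc j) c = integral\<^sup>N (\<Pi>\<^sub>M i\<in>{1..Suc j}. lborel) F"
    by (simp only: cube_nn_integral_def F_def)
  also have "\<dots> = (\<integral>\<^sup>+y. (\<integral>\<^sup>+x. F (x(Suc j := y)) \<partial>(\<Pi>\<^sub>M i\<in>{1..j}. lborel)) \<partial>lborel)"
    unfolding ins
  proof (rule product_nn_integral_insert_rev)
    show "F \<in> borel_measurable (\<Pi>\<^sub>M i\<in>insert (Suc j) {1..j}. lborel)"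
      unfolding ins[symmetric] by measurable
  qed auto
  also have "\<dots> = (\<integral>\<^sup>+y\<in>{0..1}. cube_nn_integral j (1 + y * c) \<partial>lborel)"
  proof (rule nn_integral_cong)
    fix y :: real
    have "(\<integral>\<^sup>+x. F (x(Suc j := y)) \<partial>(\<Pi>\<^sub>M i\<in>{1..j}. lborel)) =
      (\<integral>\<^sup>+x. ennreal (1 / nested_denom j (1 + y * c) x) * indicator (\<Pi>\<^sub>E i\<in>{1..j}. {0..1}) x *
        indicator {0..1} y \<partial>(\<Pi>\<^sub>M i\<in>{1..j}. lborel))"
    proof (rule nn_integral_cong)
      fix x :: "nat \<Rightarrow> real" assume "x \<in> space (\<Pi>\<^sub>M i\<in>{1..j}. lborel)"
      then have x: "x \<in> extensional {1..j}"
        by (auto simp: space_PiM PiE_def)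
      \<comment> \<open>Membership in the smaller cube also demands that \<open>x\<close> be
        undefined at \<open>Suc j\<close>. The update erases this information, so it is taken from
        the space of the measure.\<close>
      have "x(Suc j := y) \<in> (\<Pi>\<^sub>E i\<in>{1..Suc j}. {0..1}) \<longleftrightarrow>
          x \<in> (\<Pi>\<^sub>E i\<in>{1..j}. {0..1}) \<and> y \<in> {0..1}"
        using x unfolding ins PiE_iff by (auto simp: extensional_def)
      then show "F (x(Suc j := y)) = ennreal (1 / nested_denom j (1 + y * c) x) *
          indicator (\<Pi>\<^sub>E i\<in>{1..j}. {0..1}) x * indicator {0..1} y"
        by (simp add: F_def nested_denom_Suc indicator_def)
    qed
    also have "\<dots> = cube_nn_integral j (1 + y * c) * indicator {0..1} y"
      unfolding cube_nn_integral_def by (rule nn_integral_multc) measurable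
    finally show "(\<integral>\<^sup>+x. F (x(Suc j := y)) \<partial>(\<Pi>\<^sub>M i\<in>{1..j}. lborel)) =
      cube_nn_integral j (1 + y * c) * indicator {0..1} y" .
  qed
  finally show ?thesis .
qed

lemma cube_nn_integral_0: "cube_nn_integral 0 c = ennreal (1 / c)"
proof -
  interpret product_sigma_finite "\<lambda>_::nat. lborel :: real measure" ..
  show ?thesis
    by (simp add: cube_nn_integral_def nn_integral_empty)
qed

text \<open>This integrates \<open>1 / D = \<integral> exp (- s D) ds\<close> over the cube. At
  \<open>j = 0\<close> the case \<open>c = 0\<close> must be excluded, as \<open>1 / 0 = 0\<close>
  while the right side is infinite; the induction only passes to
  \<open>1 + y * c > 0\<close>.\<close>

lemma cube_nn_integral_eq_laplace:
  assumes "0 \<le> c" "j = 0 \<Longrightarrow> 0 < c"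
  shows "cube_nn_integral j c = (\<integral>\<^sup>+s\<in>{0..}. nested_laplace j s c \<partial>lborel)"
  using assms
proof (induction j arbitrary: c)
  case 0
  then show ?case
    by (simp add: cube_nn_integral_0 nn_integral_exp_Ici)
next
  case (Suc j)
  have "cube_nn_integral (Suc j) c =
      (\<integral>\<^sup>+y. (\<integral>\<^sup>+s\<in>{0..}. nested_laplace j s (1 + y * c) \<partial>lborel) * indicator {0..1} y \<partial>lborel)"
    unfolding cube_nn_integral_Suc
  proof (rule nn_integral_cong)
    fix y :: real
    have "0 < 1 + y * c" if "y \<in> {0..1}"
      using that Suc.prems by (intro add_pos_nonneg mult_nonneg_nonneg) auto
    then show "cube_nn_integral j (1 + y * c) * indicator {0..1} y =
        (\<integral>\<^sup>+s\<in>{0..}. nested_laplace j s (1 + y * c) \<partial>lborel) * indicator {0..1} y"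
      using Suc.IH[of "1 + y * c"] by (auto simp: indicator_def)
  qed
  also have "\<dots> = (\<integral>\<^sup>+s\<in>{0..}. (\<integral>\<^sup>+y\<in>{0..1}. nested_laplace j s (1 + y * c) \<partial>lborel) \<partial>lborel)"
    by (rule set_nn_integral_swap) auto
  finally show ?case
    by (simp only: nested_laplace_Suc_right)
qed

section \<open>Contraction and the error bound\<close>

lemma nn_integral_linear_01:
  assumes "0 \<le> (b::real)"
  shows "(\<integral>\<^sup>+x\<in>{0..1}. ennreal (b * x) \<partial>lborel) = ennreal (b / 2)"
proof -
  have "(\<integral>\<^sup>+x\<in>{0..1}. ennreal (b * x) \<partial>lborel) = ennreal (b * 1\<^sup>2 / 2 - b * 0\<^sup>2 / 2)"
    using assms by (intro nn_integral_FTC_Icc) (auto intro!: derivative_eq_intros)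
  then show ?thesis
    by simp
qed

text \<open>
  The recursion for the Laplace transforms contracts by the factor \<open>1/2\<close> with respect to the weight
  \<open>s\<close>, because \<open>x\<close> has mean \<open>1/2\<close> on the unit interval.
\<close>

lemma laplace_step_le:
  fixes f g :: "real \<Rightarrow> ennreal"
  assumes [measurable]: "f \<in> borel_measurable borel" "g \<in> borel_measurable borel"
    and le: "\<And>s. 0 \<le> s \<Longrightarrow> f s \<le> g s + ennreal (b * s)" and "0 \<le> b" "0 \<le> s"
  shows "ennreal (exp (- s)) * (\<integral>\<^sup>+x\<in>{0..1}. f (s * x) \<partial>lborel) \<le>
    ennreal (exp (- s)) * (\<integral>\<^sup>+x\<in>{0..1}. g (s * x) \<partial>lborel) + ennreal (b / 2 * (s * exp (- s)))"
proof -
  have "(\<integral>\<^sup>+x\<in>{0..1}. f (s * x) \<partial>lborel) \<le>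
      (\<integral>\<^sup>+x. g (s * x) * indicator {0..1} x + ennreal (b * s * x) * indicator {0..1} x \<partial>lborel)"
    using le[of "s * _"] \<open>0 \<le> s\<close> by (intro nn_integral_mono) (auto simp: indicator_def mult_ac)
  also have "\<dots> = (\<integral>\<^sup>+x\<in>{0..1}. g (s * x) \<partial>lborel) + ennreal (b * s / 2)"
    using assms(4,5) by (subst nn_integral_add) (auto simp: nn_integral_linear_01)
  finally have "ennreal (exp (- s)) * (\<integral>\<^sup>+x\<in>{0..1}. f (s * x) \<partial>lborel) \<le>
      ennreal (exp (- s)) * ((\<integral>\<^sup>+x\<in>{0..1}. g (s * x) \<partial>lborel) + ennreal (b * s / 2))"
    by (intro mult_left_mono) auto
  then show ?thesis
    using assms(4,5) by (simp add: distrib_left mult_ac flip: ennreal_mult')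
qed

text \<open>Dropping \<open>exp (- s)\<close> from the error gives a bound of the same shape as the
  hypothesis, so that the step can be iterated.\<close>

lemma laplace_step_le':
  fixes f g :: "real \<Rightarrow> ennreal"
  assumes "f \<in> borel_measurable borel" "g \<in> borel_measurable borel"
    and "\<And>s. 0 \<le> s \<Longrightarrow> f s \<le> g s + ennreal (b * s)" "0 \<le> b" "0 \<le> s"
  shows "ennreal (exp (- s)) * (\<integral>\<^sup>+x\<in>{0..1}. f (s * x) \<partial>lborel) \<le>
    ennreal (exp (- s)) * (\<integral>\<^sup>+x\<in>{0..1}. g (s * x) \<partial>lborel) + ennreal (b / 2 * s)"
proof -
  have "b / 2 * (s * exp (- s)) \<le> b / 2 * s"
    using assms(4,5) by (intro mult_left_mono mult_left_le) auto
  then show ?thesis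
    using laplace_step_le[OF assms] by (meson add_left_mono ennreal_leI order_trans)
qed

text \<open>Since \<open>stat_laplace\<close> is a fixed point, the contraction step applies in both
  directions. Two additive inequalities avoid the truncated subtraction of
  \<open>ennreal\<close>.\<close>

lemma nested_laplace_close:
  assumes "0 \<le> c"
  shows "0 \<le> s \<Longrightarrow>
    nested_laplace j s c \<le> ennreal (stat_laplace s) + ennreal ((2 + c) / 2 ^ j * s) \<and>
    ennreal (stat_laplace s) \<le> nested_laplace j s c + ennreal ((2 + c) / 2 ^ j * s)"
proof (induction j arbitrary: s)
  case 0
  \<comment> \<open>Both functions are at most \<open>1\<close> and fall short of it by at most
    \<open>s * c\<close> and \<open>2 * s\<close>, whence the constant \<open>2 + c\<close>.\<close>
  have "exp (- (s * c)) \<ge> 1 - s * c" "stat_laplace s \<ge> 1 - 2 * s"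
    using exp_ge_add_one_self[of "- (s * c)"] exp_ge_add_one_self[of "- s - ein s"]
      ein_le[OF 0] unfolding stat_laplace_def by linarith+
  moreover have "exp (- (s * c)) \<le> 1" "stat_laplace s \<le> 1"
    using 0 assms ein_nonneg[of s] by (auto simp: stat_laplace_def)
  moreover have "0 \<le> s * c"
    using 0 assms(1) by simp
  moreover have eq: "(2 + c) / 2 ^ 0 * s = 2 * s + s * c"
    by (simp add: algebra_simps)
  ultimately have
    "exp (- (s * c)) \<le> stat_laplace s + (2 + c) / 2 ^ 0 * s"
    "stat_laplace s \<le> exp (- (s * c)) + (2 + c) / 2 ^ 0 * s"
    using 0 by linarith+
  moreover have "0 \<le> (2 + c) / 2 ^ 0 * s"
    using 0 assms by simp
  ultimately show ?case
    by (simp add: ennreal_leI del: power_0 flip: ennreal_plus)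
next
  case (Suc j)
  have K: "(2 + c) / 2 ^ Suc j = (2 + c) / 2 ^ j / 2" "0 \<le> (2 + c) / 2 ^ j"
    using assms(1) by auto
  have "nested_laplace (Suc j) s c \<le> ennreal (stat_laplace s) + ennreal ((2 + c) / 2 ^ Suc j * s)"
    unfolding nested_laplace.simps(2) stat_laplace_fixed_point[OF \<open>0 \<le> s\<close>] K(1)
    using Suc K(2)
    by (intro laplace_step_le'[where f = "\<lambda>s. nested_laplace j s c"]) auto
  moreover have "ennreal (stat_laplace s) \<le> nested_laplace (Suc j) s c + ennreal ((2 + c) / 2 ^ Suc j * s)"
    unfolding nested_laplace.simps(2) stat_laplace_fixed_point[OF \<open>0 \<le> s\<close>] K(1)
    using Suc K(2)
    by (intro laplace_step_le'[where g = "\<lambda>s. nested_laplace j s c"]) auto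
  ultimately show ?case ..
qed

lemma nn_integral_Ici_le_add:
  fixes f g :: "real \<Rightarrow> ennreal"
  assumes [measurable]: "g \<in> borel_measurable borel"
    and le: "\<And>s. 0 \<le> s \<Longrightarrow> f s \<le> g s + ennreal (b * (s * exp (- s)))" and "0 \<le> b"
  shows "(\<integral>\<^sup>+s\<in>{0..}. f s \<partial>lborel) \<le> (\<integral>\<^sup>+s\<in>{0..}. g s \<partial>lborel) + ennreal b"
proof -
  have "(\<integral>\<^sup>+s\<in>{0..}. f s \<partial>lborel) \<le>
      (\<integral>\<^sup>+s. g s * indicator {0..} s + ennreal b * (ennreal (s * exp (- s)) * indicator {0..} s) \<partial>lborel)"
    using le \<open>0 \<le> b\<close> by (intro nn_integral_mono) (auto simp: indicator_def ennreal_mult')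
  also have "\<dots> = (\<integral>\<^sup>+s\<in>{0..}. g s \<partial>lborel) + ennreal b"
    by (subst nn_integral_add) (auto simp: nn_integral_cmult nn_integral_id_exp_Ici)
  finally show ?thesis .
qed

text \<open>The error \<open>(2 + c) / 2 ^ k * s\<close> is not integrable over the half-line. One
  more step, keeping \<open>exp (- s)\<close>, makes it so, and \<open>s * exp (- s)\<close> has
  integral \<open>1\<close>.\<close>

lemma cube_nn_integral_close:
  assumes "0 \<le> c" "0 < j"
  shows "cube_nn_integral j c \<le> ennreal (exp (- euler_mascheroni)) + ennreal ((2 + c) / 2 ^ j)"
    and "ennreal (exp (- euler_mascheroni)) \<le> cube_nn_integral j c + ennreal ((2 + c) / 2 ^ j)"
proof -
  obtain k where j: "j = Suc k"
    using assms(2) gr0_implies_Suc by auto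
  have eq: "cube_nn_integral j c = (\<integral>\<^sup>+s\<in>{0..}. nested_laplace j s c \<partial>lborel)"
    using assms by (intro cube_nn_integral_eq_laplace) auto
  have K: "(2 + c) / 2 ^ j = (2 + c) / 2 ^ k / 2" "0 \<le> (2 + c) / 2 ^ j" "0 \<le> (2 + c) / 2 ^ k"
    using assms by (auto simp: j)
  have "nested_laplace j s c \<le> ennreal (stat_laplace s) + ennreal ((2 + c) / 2 ^ j * (s * exp (- s)))"
    if "0 \<le> s" for s
    unfolding j nested_laplace.simps(2) stat_laplace_fixed_point[OF that] K(1)[unfolded j]
    using that K(3) nested_laplace_close[OF assms(1)]
    by (intro laplace_step_le[where f = "\<lambda>s. nested_laplace k s c"]) auto
  then show "cube_nn_integral j c \<le> ennreal (exp (- euler_mascheroni)) + ennreal ((2 + c) / 2 ^ j)"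
    unfolding eq nn_integral_stat_laplace[symmetric]
    using K(2) by (intro nn_integral_Ici_le_add) auto
  have "ennreal (stat_laplace s) \<le> nested_laplace j s c + ennreal ((2 + c) / 2 ^ j * (s * exp (- s)))"
    if "0 \<le> s" for s
    unfolding j nested_laplace.simps(2) stat_laplace_fixed_point[OF that] K(1)[unfolded j]
    using that K(3) nested_laplace_close[OF assms(1)]
    by (intro laplace_step_le[where g = "\<lambda>s. nested_laplace k s c"]) auto
  then show "ennreal (exp (- euler_mascheroni)) \<le> cube_nn_integral j c + ennreal ((2 + c) / 2 ^ j)"
    unfolding eq nn_integral_stat_laplace[symmetric]
    using K(2) by (intro nn_integral_Ici_le_add) auto
qed

lemma nested_integral_close:
  assumes "0 \<le> c" "0 < j"
  shows "\<bar>nested_integral j c - exp (- euler_mascheroni)\<bar> \<le> (2 + c) / 2 ^ j"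
proof -
  have K: "0 \<le> (2 + c) / 2 ^ j"
    using assms by simp
  \<comment> \<open>Finiteness comes first because \<open>enn2real\<close> sends \<open>top\<close>
    to \<open>0\<close>.\<close>
  have "cube_nn_integral j c < top"
    using cube_nn_integral_close(1)[OF assms]
    by (rule le_less_trans) (simp add: ennreal_add_less_top)
  then have N: "cube_nn_integral j c = ennreal (nested_integral j c)" "0 \<le> nested_integral j c"
    using assms by (auto simp: nested_integral_eq_cube_nn_integral)
  show ?thesis
    using cube_nn_integral_close[OF assms] K N(2) unfolding N(1)
    by (simp add: abs_le_iff flip: ennreal_plus)
qed

theorem theorem4p8:
  "\<exists>C::real. \<forall>c :: nat \<Rightarrow> real. (\<forall>j\<ge>1. 0 \<le> c j) \<longrightarrow>
     (\<forall>j\<ge>1. \<bar>nested_integral j (c j) - exp (- euler_mascheroni)\<bar>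
               \<le> C * (2 powr (- real j) * (1 + c j)))"
\<comment> \<open>The constant \<open>2\<close> suffices since
  \<open>2 + c \<le> 2 * (1 + c)\<close> for nonnegative \<open>c\<close>.\<close>
proof (intro exI[of _ 2] allI impI)
  fix c :: "nat \<Rightarrow> real" and j :: nat
  assume "\<forall>j\<ge>1. 0 \<le> c j" and j: "1 \<le> j"
  then have c: "0 \<le> c j"
    by blast
  have "\<bar>nested_integral j (c j) - exp (- euler_mascheroni)\<bar> \<le> (2 + c j) / 2 ^ j"
    using c j by (intro nested_integral_close) auto
  also have "\<dots> \<le> 2 * (1 + c j) / 2 ^ j"
    using c by (intro divide_right_mono) auto
  also have "\<dots> = 2 * (2 powr (- real j) * (1 + c j))"
    by (simp add: powr_minus powr_realpow divide_inverse)
  finally show "\<bar>nested_integral j (c j) - exp (- euler_mascheroni)\<bar>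
      \<le> 2 * (2 powr (- real j) * (1 + c j))" .
qed

end
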